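(* Let $P$ and $Q$ be Borel probability measures on a Polish space $\Omega$ with $Q \ll P$, and let $K$ be the index returned by any causal rejection sampler with proposal $P$ and target $Q$. Then $$D_{CS}[Q\|P]\le \mathbb{H}[K].$$
   Context: A causal rejection sampler with proposal $P$ and target $Q$ consists of a sequence $(X_i)_{i\ge 1}$ of i.i.d. random variables with $X_i\sim P$, together with a finite stopping time $K\in\{1,2,\dots\}$ adapted to the sequence (i.e. $\{K\le k\}\in\sigma(X_1,\dots,X_k)$ for every $k$), such that $X_K\sim Q$. The index returned is $K$. For $Q\ll P$ define $w(h)=P\left(\frac{dQ}{dP}\ge h\right)$ for $h\ge 0$. The channel simulation divergence is $$D_{CS}[Q\|P]=-\int_0^\infty w(h)\log_2 w(h)\,dh\in[0,\infty],$$ with the convention $0\log_2 0=0$. $\mathbb{H}[K]=-\sum_k \mathbb{P}[K=k]\log_2\mathbb{P}[K=k]\in[0,\infty]$ is the Shannon entropy in bits. *)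

theory Defs
  imports "HOL-Probability.Probability"
begin

definition natural_filtration ::
    "'w measure \<Rightarrow> (nat \<Rightarrow> 'w \<Rightarrow> 'a::topological_space) \<Rightarrow> nat \<Rightarrow> 'w measure" where
  "natural_filtration M X k =
     sigma (space M) (\<Union>i\<in>{1..k}. {X i -` A \<inter> space M | A. A \<in> sets borel})"

(* Proposals are indexed from 1; the value X 0 is unconstrained and never used.  The stopping
   time is finite because K has type nat. *)
definition causal_rejection_sampler ::
    "'w measure \<Rightarrow> 'a::topological_space measure \<Rightarrow> 'a measure \<Rightarrow>
     (nat \<Rightarrow> 'w \<Rightarrow> 'a) \<Rightarrow> ('w \<Rightarrow> nat) \<Rightarrow> bool" where
  "causal_rejection_sampler M P Q X K \<longleftrightarrow>
     prob_space M \<and>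
     prob_space.indep_vars M (\<lambda>_. borel) X {1..} \<and>
     (\<forall>i\<ge>1. distr M borel (X i) = P) \<and>
     (\<forall>\<omega>\<in>space M. 1 \<le> K \<omega>) \<and>
     stopping_time (natural_filtration M X) K \<and>
     distr M borel (\<lambda>\<omega>. X (K \<omega>) \<omega>) = Q"

definition width :: "'a measure \<Rightarrow> 'a measure \<Rightarrow> real \<Rightarrow> real" where
  "width P Q h = measure P {x \<in> space P. ennreal h \<le> RN_deriv P Q x}"

(* Both quantities below take values in [0,\<infinity>]: the integrand and the summands are
   nonnegative reals, so ennreal does not truncate, and log 2 0 = 0 gives 0 * log 2 0 = 0. *)
definition channel_simulation_divergence :: "'a measure \<Rightarrow> 'a measure \<Rightarrow> ennreal" where
  "channel_simulation_divergence P Q =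
     (\<integral>\<^sup>+h\<in>{0..}. ennreal (- (width P Q h * log 2 (width P Q h))) \<partial>lborel)"

(* The library's entropy is a Bochner integral, which is 0 rather than \<infinity> when the
   series diverges. *)
definition shannon_entropy :: "'w measure \<Rightarrow> ('w \<Rightarrow> nat) \<Rightarrow> ennreal" where
  "shannon_entropy M K =
     (\<Sum>k. let p = measure M {\<omega> \<in> space M. K \<omega> = k} in ennreal (- (p * log 2 p)))"

end

(* Put mu_k(A) = Pr[K = k, X_K in A]. Then mu_k <= P, mu_k has mass p_k = Pr[K = k], and the mu_k
   sum to Q.
   With r = dQ/dP, J = {k. p_k >= c} and n = |J|, bounding mu_k by P for k in J and by p_k
   otherwise gives
     integral min(w,c) <= n c + integral_n^oo w = n c + integral (r - n)^+ dP <= sum_k min(p_k,c).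
   Since w has integral 1 and the p_k have sum 1, integrating this against dc/c turns it into the
   entropy inequality, by  - x ln x = integral_0^1 (min(x,c) - x c)/c dc  for x in [0,1]. *)

theory Submission
  imports Defs
begin

section \<open>Layer-cake formula above a given level\<close>

lemma emeasure_lborel_upto_ennreal:
  fixes r :: ennreal
  assumes "0 \<le> a"
  shows "emeasure lborel {h. a \<le> h \<and> ennreal h \<le> r} = r - ennreal a"
proof (cases r)
  case (real s)
  then have "{h. a \<le> h \<and> ennreal h \<le> r} = {a..s}"
    using assms by auto
  moreover have "emeasure lborel {a..s} = ennreal s - ennreal a"
    using real assms by (simp add: ennreal_minus emeasure_lborel_Icc_eq ennreal_neg)
  ultimately show ?thesis
    using real by simp
next
  case top
  have "emeasure lborel {a..} = top"
  proof (cases "emeasure lborel {a..}")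
    case (real s)
    \<comment> \<open>A finite value \<open>s\<close> is contradicted by an interval of length
      \<open>s + 1\<close> inside the half-line.\<close>
    have "emeasure lborel {a..a + (s + 1)} \<le> emeasure lborel {a..}"
      by (intro emeasure_mono) auto
    with real show ?thesis by simp
  qed
  then show ?thesis
    using top by (simp add: atLeast_def[symmetric])
qed

text \<open>Both sides measure the region \<open>a \<le> h \<le> f x\<close> in the product of
  \<open>P\<close> and Lebesgue measure; Fubini slices it by \<open>h\<close> or by
  \<open>x\<close>. Subtraction truncates at 0, so points with \<open>f x < a\<close> contribute
  nothing.\<close>

lemma nn_integral_superlevel:
  fixes f :: "'a \<Rightarrow> ennreal"
  assumes "sigma_finite_measure P" and [measurable]: "f \<in> borel_measurable P" and "0 \<le> a"
  shows "(\<integral>\<^sup>+h\<in>{a..}. emeasure P {x \<in> space P. ennreal h \<le> f x} \<partial>lborel) =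
    (\<integral>\<^sup>+x. f x - ennreal a \<partial>P)"
proof -
  interpret P: sigma_finite_measure P by fact
  interpret pair_sigma_finite P lborel ..
  let ?g = "\<lambda>x h. indicator {h. a \<le> h \<and> ennreal h \<le> f x} h :: ennreal"
  have "(\<integral>\<^sup>+h\<in>{a..}. emeasure P {x \<in> space P. ennreal h \<le> f x} \<partial>lborel) =
    (\<integral>\<^sup>+h. \<integral>\<^sup>+x. ?g x h \<partial>P \<partial>lborel)"
  proof (intro nn_integral_cong)
    fix h :: real
    have "(\<integral>\<^sup>+x. ?g x h \<partial>P) =
      (\<integral>\<^sup>+x. indicator {a..} h * indicator {x \<in> space P. ennreal h \<le> f x} x \<partial>P)"
      by (intro nn_integral_cong) (auto split: split_indicator)
    also have "\<dots> = indicator {a..} h * emeasure P {x \<in> space P. ennreal h \<le> f x}"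
      by (subst nn_integral_cmult_indicator) auto
    finally show "emeasure P {x \<in> space P. ennreal h \<le> f x} * indicator {a..} h =
        (\<integral>\<^sup>+x. ?g x h \<partial>P)"
      by (simp add: mult.commute)
  qed
  also have "\<dots> = (\<integral>\<^sup>+x. \<integral>\<^sup>+h. ?g x h \<partial>lborel \<partial>P)"
    by (rule Fubini') measurable
  also have "\<dots> = (\<integral>\<^sup>+x. f x - ennreal a \<partial>P)"
  proof (intro nn_integral_cong)
    fix x
    have "{h. a \<le> h \<and> ennreal h \<le> f x} \<in> sets lborel"
      by measurable
    then show "(\<integral>\<^sup>+h. ?g x h \<partial>lborel) = f x - ennreal a"
      using emeasure_lborel_upto_ennreal[OF \<open>0 \<le> a\<close>] by simp
  qed
  finally show ?thesis .
qed

section \<open>Integral representation of the function - x ln x\<close>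

lemma nn_integral_min_kernel:
  fixes x :: real
  assumes "0 \<le> x" "x \<le> 1"
  shows "(\<integral>\<^sup>+c\<in>{0<..<1}. ennreal ((min x c - x * c) / c) \<partial>lborel) = ennreal (- (x * ln x))"
proof (cases "x = 0")
  case True
  then show ?thesis by (auto intro!: nn_integral_zero' simp: indicator_def)
next
  case False
  with assms have x: "0 < x" by simp
  \<comment> \<open>The minimum switches at \<open>c = x\<close>: the integrand is
    \<open>1 - x\<close> before it and \<open>x / c - x\<close> after it. The closed intervals
    differ from this only at the null points 0, \<open>x\<close> and 1.\<close>
  have split: "(\<integral>\<^sup>+c\<in>{0<..<1}. ennreal ((min x c - x * c) / c) \<partial>lborel) =
    (\<integral>\<^sup>+c. ennreal (1 - x) * indicator {0..x} c + ennreal (x / c - x) * indicator {x..1} c \<partial>lborel)"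
  proof (rule nn_integral_cong_AE)
    have "AE c in lborel. c \<noteq> 0 \<and> c \<noteq> x \<and> c \<noteq> 1"
      using AE_lborel_singleton[of 0] AE_lborel_singleton[of x] AE_lborel_singleton[of 1] by eventually_elim auto
    then show "AE c in lborel. ennreal ((min x c - x * c) / c) * indicator {0<..<1} c =
      ennreal (1 - x) * indicator {0..x} c + ennreal (x / c - x) * indicator {x..1} c"
    proof eventually_elim
      case (elim c)
      then show ?case
        using x assms by (auto simp: indicator_def min_def field_simps)
    qed
  qed
  have "(\<integral>\<^sup>+c. ennreal (x / c - x) * indicator {x..1} c \<partial>lborel) =
      ennreal ((x * ln 1 - x * 1) - (x * ln x - x * x))"
    using x assms
    by (intro nn_integral_FTC_Icc[where F="\<lambda>c. x * ln c - x * c"])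
      (auto intro!: derivative_eq_intros simp: field_simps mult_left_le)
  moreover have "(\<integral>\<^sup>+c. ennreal (1 - x) * indicator {0..x} c \<partial>lborel) = ennreal ((1 - x) * x)"
    using x assms by (simp add: nn_integral_cmult_indicator ennreal_mult)
  \<comment> \<open>This says that the integral over \<open>{x..1}\<close> is nonnegative as a real
    number, so the two pieces can be added inside \<open>ennreal\<close> without truncation.\<close>
  moreover have "x * ln x \<le> x * (x - 1)"
    using x ln_le_minus_one by (intro mult_left_mono) auto
  ultimately show ?thesis
    using x assms unfolding split
    by (subst nn_integral_add) (auto simp: ennreal_plus[symmetric] algebra_simps simp del: ennreal_plus)
qed

section \<open>Truncated integrals of the width function\<close>

lemma mixture_excess:
  fixes p :: "nat \<Rightarrow> real"
  assumes "finite J"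
    and Q: "emeasure Q A = (\<Sum>k. \<mu> k)"
    and P: "\<And>k. \<mu> k \<le> emeasure P A"
    and p: "\<And>k. \<mu> k \<le> ennreal (p k)"
  shows "emeasure Q A \<le> of_nat (card J) * emeasure P A + (\<Sum>k. if k \<in> J then 0 else ennreal (p k))"
proof -
  have "emeasure Q A \<le> (\<Sum>k. (if k \<in> J then emeasure P A else 0) + (if k \<in> J then 0 else ennreal (p k)))"
    unfolding Q using P p by (intro suminf_le) auto
  also have "\<dots> = (\<Sum>k. if k \<in> J then emeasure P A else 0) + (\<Sum>k. if k \<in> J then 0 else ennreal (p k))"
    by (intro suminf_add[symmetric]) auto
  also have "(\<Sum>k. if k \<in> J then emeasure P A else 0) = of_nat (card J) * emeasure P A"
    using \<open>finite J\<close> by (subst suminf_finite[of J]) auto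
  finally show ?thesis .
qed

lemma width_measurable [measurable]: "width P Q \<in> borel_measurable borel" if "finite_measure P"
proof -
  interpret finite_measure P by fact
  \<comment> \<open>Superlevel sets shrink as \<open>h\<close> grows; monotonicity then gives Borel
    measurability.\<close>
  have "mono (\<lambda>h. - width P Q h)"
    unfolding width_def
    by (intro monoI) (auto intro!: finite_measure_mono intro: order_trans ennreal_leI)
  then show ?thesis
    using borel_measurable_uminus_eq borel_measurable_mono by blast
qed

text \<open>With r = dQ/dP, the tail integral of the width is the integral of the positive part of r
  - a. Adding a back on \<open>A\<close> restores r there, while off \<open>A\<close> both terms
  vanish, so the total is the integral of r over \<open>A\<close>. The additive form avoids
  subtracting in \<open>ennreal\<close>.\<close>

lemma width_integral_excess:
  assumes "prob_space P" "prob_space Q" "sets Q = sets P" "absolutely_continuous P Q" "0 \<le> a"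
    and A: "A = {x \<in> space P. ennreal a \<le> RN_deriv P Q x}"
  shows "(\<integral>\<^sup>+h\<in>{a..}. ennreal (width P Q h) \<partial>lborel) + ennreal a * emeasure P A = emeasure Q A"
proof -
  interpret P: prob_space P by fact
  interpret Q: prob_space Q by fact
  have [measurable]: "A \<in> sets P" unfolding A by measurable
  \<comment> \<open>Off \<open>A\<close> the density is below \<open>a\<close>, hence finite; this
    excludes the case \<open>top - top\<close>, which is not 0 in \<open>ennreal\<close>.\<close>
  have less_top_a: "y < top" if "y < ennreal a" for y
    using that ennreal_less_top by (rule less_trans)
  have "(\<integral>\<^sup>+h\<in>{a..}. ennreal (width P Q h) \<partial>lborel) = (\<integral>\<^sup>+x. RN_deriv P Q x - ennreal a \<partial>P)"
    using \<open>0 \<le> a\<close> P.sigma_finite_measure_axioms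
    by (simp add: width_def P.emeasure_eq_measure[symmetric] nn_integral_superlevel)
  also have "\<dots> + ennreal a * emeasure P A =
      (\<integral>\<^sup>+x. (RN_deriv P Q x - ennreal a) + ennreal a * indicator A x \<partial>P)"
    by (subst nn_integral_add) (auto simp: nn_integral_cmult_indicator)
  also have "\<dots> = (\<integral>\<^sup>+x. RN_deriv P Q x * indicator A x \<partial>P)"
    by (intro nn_integral_cong)
      (auto simp: A indicator_def diff_eq_0_iff_ennreal not_le intro!: diff_add_cancel_ennreal
        intro: less_top_a)
  also have "\<dots> = emeasure Q A"
    by (subst (2) P.density_RN_deriv[symmetric])
      (use assms in \<open>auto simp: emeasure_density\<close>)
  finally show ?thesis .
qed

lemma nn_integral_min_width_le:
  fixes p :: "nat \<Rightarrow> real"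
  assumes "prob_space P" "prob_space Q" "sets Q = sets P" "absolutely_continuous P Q"
    and Q: "\<And>A. A \<in> sets P \<Longrightarrow> emeasure Q A = (\<Sum>k. \<mu> k A)"
    and P: "\<And>A k. A \<in> sets P \<Longrightarrow> \<mu> k A \<le> emeasure P A"
    and p: "\<And>A k. A \<in> sets P \<Longrightarrow> \<mu> k A \<le> ennreal (p k)"
    and "summable p" "\<And>k. 0 \<le> p k" "0 < c"
  shows "(\<integral>\<^sup>+h\<in>{0..}. ennreal (min (width P Q h) c) \<partial>lborel) \<le> (\<Sum>k. ennreal (min (p k) c))"
proof -
  interpret P: prob_space P by fact
  interpret Q: prob_space Q by fact
  define J where "J = {k. c \<le> p k}"
  \<comment> \<open>The terms of a convergent series tend to 0, so only finitely many reach the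
    positive threshold \<open>c\<close>.\<close>
  have "eventually (\<lambda>k. p k < c) sequentially"
    using summable_LIMSEQ_zero[OF \<open>summable p\<close>] \<open>0 < c\<close> by (rule order_tendstoD)
  then have "finite J"
    unfolding J_def by (simp add: cofinite_eq_sequentially[symmetric] eventually_cofinite not_less)
  define n where "n = real (card J)"
  define A where "A = {x \<in> space P. ennreal n \<le> RN_deriv P Q x}"
  have A: "A \<in> sets P" unfolding A_def by measurable
  have w [measurable]: "width P Q \<in> borel_measurable borel"
    by (rule width_measurable) (rule P.finite_measure_axioms)
  have n: "0 \<le> n" "ennreal n = of_nat (card J)"
    by (simp_all add: n_def ennreal_of_nat_eq_real_of_nat)
  let ?R = "\<Sum>k. if k \<in> J then 0 else ennreal (p k)"
  \<comment> \<open>Taking the level equal to the number of indices in \<open>J\<close> makes the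
    term \<open>n * P(A)\<close> the same in the width identity and in the mixture bound. It is
    finite and cancels.\<close>
  have "(\<integral>\<^sup>+h\<in>{n..}. ennreal (width P Q h) \<partial>lborel) + ennreal n * emeasure P A \<le>
      ?R + ennreal n * emeasure P A"
    using width_integral_excess[OF assms(1-4) n(1) A_def]
      mixture_excess[OF \<open>finite J\<close> Q P p, OF A A A] by (simp add: n add.commute)
  then have tail: "(\<integral>\<^sup>+h\<in>{n..}. ennreal (width P Q h) \<partial>lborel) \<le> ?R"
    by (simp add: add.commute[of _ "ennreal n * _"] ennreal_add_left_cancel_le ennreal_mult_eq_top_iff)
  \<comment> \<open>The minimum is bounded by \<open>c\<close> up to \<open>n\<close> and by the
    width beyond; the overlap at \<open>n\<close> only enlarges the upper bound.\<close>
  have "(\<integral>\<^sup>+h\<in>{0..}. ennreal (min (width P Q h) c) \<partial>lborel) \<le>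
      (\<integral>\<^sup>+h. ennreal c * indicator {0..n} h + ennreal (width P Q h) * indicator {n..} h \<partial>lborel)"
    by (intro nn_integral_mono) (auto simp: indicator_def intro!: ennreal_leI add_increasing add_increasing2)
  also have "\<dots> = ennreal c * ennreal n + (\<integral>\<^sup>+h\<in>{n..}. ennreal (width P Q h) \<partial>lborel)"
    using n(1) by (subst nn_integral_add) (auto simp: nn_integral_cmult_indicator)
  also have "\<dots> \<le> ennreal c * ennreal n + ?R"
    using tail by (rule add_left_mono)
  \<comment> \<open>Spreading \<open>c * n\<close> as one \<open>c\<close> per index in
    \<open>J\<close> lets it merge with the remainder: \<open>J\<close> holds exactly the indices
    where the minimum of \<open>p k\<close> and \<open>c\<close> is \<open>c\<close>.\<close>
  also have "ennreal c * ennreal n = (\<Sum>k. if k \<in> J then ennreal c else 0)"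
    using \<open>finite J\<close> by (subst suminf_finite[of J]) (auto simp: n mult.commute)
  also have "\<dots> + ?R = (\<Sum>k. (if k \<in> J then ennreal c else 0) + (if k \<in> J then 0 else ennreal (p k)))"
    by (intro suminf_add) auto
  also have "\<dots> = (\<Sum>k. ennreal (min (p k) c))"
    by (intro suminf_cong) (auto simp: J_def min_def)
  finally show ?thesis .
qed

section \<open>From truncated integrals to entropy\<close>

lemma ennreal_min_decomp:
  assumes "0 \<le> x" "x \<le> 1" "0 \<le> c" "c \<le> 1"
  shows "ennreal (min x c) = ennreal (min x c - x * c) + ennreal c * ennreal x"
    and "0 \<le> min x c - x * c"
proof -
  show *: "0 \<le> min x c - x * c"
    using assms by (auto simp: min_def mult_left_le mult_left_le_one_le)
  show "ennreal (min x c) = ennreal (min x c - x * c) + ennreal c * ennreal x"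
    using assms * by (simp add: ennreal_mult[symmetric] ennreal_plus[symmetric] mult.commute del: ennreal_plus)
qed

text \<open>The sampler enters only through the decomposition of \<open>Q\<close> into pieces
  dominated both by \<open>P\<close> and by their weights \<open>p k\<close>. Both sides are then
  integrals over \<open>c\<close> of the same kernel, which are compared for each fixed
  \<open>c\<close>.\<close>

lemma channel_simulation_divergence_mixture_le:
  fixes p :: "nat \<Rightarrow> real"
  assumes "prob_space P" "prob_space Q" "sets Q = sets P" "absolutely_continuous P Q"
    and Q: "\<And>A. A \<in> sets P \<Longrightarrow> emeasure Q A = (\<Sum>k. \<mu> k A)"
    and P: "\<And>A k. A \<in> sets P \<Longrightarrow> \<mu> k A \<le> emeasure P A"
    and p: "\<And>A k. A \<in> sets P \<Longrightarrow> \<mu> k A \<le> ennreal (p k)"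
    and sums: "p sums 1" and p0: "\<And>k. 0 \<le> p k"
  shows "channel_simulation_divergence P Q \<le> (\<Sum>k. ennreal (- (p k * log 2 (p k))))"
proof -
  interpret P: prob_space P by fact
  interpret Q: prob_space Q by fact
  let ?w = "width P Q"
  let ?G = "\<lambda>x c. ennreal ((min x c - x * c) / c) :: ennreal"
  have w [measurable]: "?w \<in> borel_measurable borel"
    by (rule width_measurable) (rule P.finite_measure_axioms)
  have w01: "0 \<le> ?w h" "?w h \<le> 1" for h
    by (simp_all add: width_def)
  have p1: "p k \<le> 1" for k
    using sum_le_suminf[of p "{k}"] sums p0 by (auto simp: sums_iff)
  have log_eq: "ennreal (- (x * log 2 x)) = ennreal (1 / ln 2) * (\<integral>\<^sup>+c\<in>{0<..<1}. ?G x c \<partial>lborel)"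
    if "0 \<le> x" "x \<le> 1" for x
  proof -
    have "- (x * log 2 x) = 1 / ln 2 * (- (x * ln x))"
      by (simp add: log_def)
    then show ?thesis
      using that by (simp only: nn_integral_min_kernel) (simp add: ennreal_mult'[symmetric])
  qed
  \<comment> \<open>At level 0 the superlevel set is the whole space and the correction term is
    zero.\<close>
  have w1: "(\<integral>\<^sup>+h\<in>{0..}. ennreal (?w h) \<partial>lborel) = 1"
    using width_integral_excess[OF assms(1-4) order_refl refl] assms(3) Q.emeasure_space_1
    by (simp add: sets_eq_imp_space_eq[OF assms(3)])
  have s1: "(\<Sum>k. ennreal (p k)) = 1"
    using suminf_ennreal_eq[OF p0 sums] by simp
  \<comment> \<open>Since the width and the weights both have total mass 1, the linear part of the
    kernel contributes the same finite amount \<open>c\<close> on each side. Adding it reduces the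
    claim to the bound on truncated minima; it is then cancelled.\<close>
  have kernel_le: "(\<integral>\<^sup>+h\<in>{0..}. ?G (?w h) c \<partial>lborel) \<le> (\<Sum>k. ?G (p k) c)" if c: "0 < c" "c < 1" for c
  proof -
    let ?D = "\<lambda>x. ennreal (min x c - x * c)"
    have G: "?G x c = ennreal (1 / c) * ?D x" if "0 \<le> x" "x \<le> 1" for x
      using c that ennreal_min_decomp(2)[of x c] by (simp add: ennreal_mult'[symmetric])
    have "(\<integral>\<^sup>+h\<in>{0..}. ?D (?w h) \<partial>lborel) + ennreal c =
        (\<integral>\<^sup>+h\<in>{0..}. ?D (?w h) \<partial>lborel) + ennreal c * (\<integral>\<^sup>+h\<in>{0..}. ennreal (?w h) \<partial>lborel)"
      by (simp add: w1)
    also have "\<dots> = (\<integral>\<^sup>+h. ?D (?w h) * indicator {0..} h + ennreal c * (ennreal (?w h) * indicator {0..} h) \<partial>lborel)"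
      by (subst nn_integral_add) (auto simp: nn_integral_cmult)
    also have "\<dots> = (\<integral>\<^sup>+h\<in>{0..}. ennreal (min (?w h) c) \<partial>lborel)"
      using c w01 by (intro nn_integral_cong) (auto simp: indicator_def ennreal_min_decomp(1))
    also have "\<dots> \<le> (\<Sum>k. ennreal (min (p k) c))"
      using sums c by (intro nn_integral_min_width_le[OF assms(1-4) Q P p _ p0]) (auto simp: sums_iff)
    also have "\<dots> = (\<Sum>k. ?D (p k) + ennreal c * ennreal (p k))"
      using c p0 p1 by (simp add: ennreal_min_decomp(1))
    also have "\<dots> = (\<Sum>k. ?D (p k)) + ennreal c"
      by (subst suminf_add[symmetric]) (auto simp: s1)
    finally have "(\<integral>\<^sup>+h\<in>{0..}. ?D (?w h) \<partial>lborel) \<le> (\<Sum>k. ?D (p k))"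
      by (simp add: add.commute[of _ "ennreal c"] ennreal_add_left_cancel_le)
    then have "ennreal (1 / c) * (\<integral>\<^sup>+h\<in>{0..}. ?D (?w h) \<partial>lborel) \<le> ennreal (1 / c) * (\<Sum>k. ?D (p k))"
      by (rule mult_left_mono) simp
    then show ?thesis
      using w01 p0 p1 by (simp add: G nn_integral_cmult[symmetric] mult.assoc)
  qed
  have "channel_simulation_divergence P Q =
      ennreal (1 / ln 2) * (\<integral>\<^sup>+h. \<integral>\<^sup>+c. ?G (?w h) c * indicator {0<..<1} c * indicator {0..} h \<partial>lborel \<partial>lborel)"
    unfolding channel_simulation_divergence_def
    by (subst nn_integral_cmult[symmetric])
      (auto simp: log_eq w01 nn_integral_multc mult.assoc[symmetric] intro!: nn_integral_cong)
  \<comment> \<open>Exchanging the integrals puts \<open>h\<close> inside, so that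
    \<open>kernel_le\<close> applies at each \<open>c\<close> in (0,1).\<close>
  also have "(\<integral>\<^sup>+h. \<integral>\<^sup>+c. ?G (?w h) c * indicator {0<..<1} c * indicator {0..} h \<partial>lborel \<partial>lborel) =
      (\<integral>\<^sup>+c. \<integral>\<^sup>+h. ?G (?w h) c * indicator {0<..<1} c * indicator {0..} h \<partial>lborel \<partial>lborel)"
    by (rule lborel_pair.Fubini'[symmetric]) measurable
  also have "\<dots> \<le> (\<integral>\<^sup>+c. (\<Sum>k. ?G (p k) c * indicator {0<..<1} c) \<partial>lborel)"
    using kernel_le by (intro nn_integral_mono) (auto simp: indicator_def)
  also have "\<dots> = (\<Sum>k. \<integral>\<^sup>+c\<in>{0<..<1}. ?G (p k) c \<partial>lborel)"
    by (rule nn_integral_suminf) measurable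
  finally have "channel_simulation_divergence P Q \<le>
      ennreal (1 / ln 2) * (\<Sum>k. \<integral>\<^sup>+c\<in>{0<..<1}. ?G (p k) c \<partial>lborel)"
    by (simp add: mult_left_mono)
  then show ?thesis
    using p0 p1 by (simp add: log_eq)
qed

section \<open>Causal rejection samplers as mixtures\<close>

lemma stopping_time_natural_filtration_measurable:
  assumes X: "\<And>i. 1 \<le> i \<Longrightarrow> X i \<in> borel_measurable M"
    and "stopping_time (natural_filtration M X) K"
  shows "K \<in> measurable M (count_space UNIV)"
proof -
  \<comment> \<open>The generators are preimages under \<open>X i\<close> with \<open>i\<close> at
    least 1, all of them events of \<open>M\<close>.\<close>
  have "sets (natural_filtration M X k) \<subseteq> sets M" for k
    unfolding natural_filtration_def using measurable_sets[OF X]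
    by (subst sets_measure_of) (auto intro!: sets.sigma_sets_subset)
  moreover have "space (natural_filtration M X k) = space M" for k
    unfolding natural_filtration_def by (rule space_measure_of) auto
  ultimately have "{\<omega> \<in> space M. K \<omega> \<le> k} \<in> sets M" for k
    using stopping_timeD[OF assms(2), of k] unfolding pred_def by auto
  then have [measurable]: "Measurable.pred M (\<lambda>\<omega>. K \<omega> \<le> k)" for k
    by (simp add: pred_def)
  have "{\<omega> \<in> space M. K \<omega> = k} \<in> sets M" for k
  proof -
    have "{\<omega> \<in> space M. K \<omega> = k} = {\<omega> \<in> space M. K \<omega> \<le> k \<and> (\<forall>j\<in>{..<k}. \<not> K \<omega> \<le> j)}"
      by (auto simp: not_le)
    also have "\<dots> \<in> sets M"
      by measurable
    finally show ?thesis .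
  qed
  moreover have "K -` {k} \<inter> space M = {\<omega> \<in> space M. K \<omega> = k}" for k
    by auto
  ultimately show ?thesis
    by (subst measurable_count_space_eq2_countable) auto
qed

theorem theoremV1:
  fixes P Q :: "'a::polish_space measure"
    and M :: "'w measure"
    and X :: "nat \<Rightarrow> 'w \<Rightarrow> 'a"
    and K :: "'w \<Rightarrow> nat"
  assumes "prob_space P" "sets P = sets borel"
    and "prob_space Q" "sets Q = sets borel"
    and "absolutely_continuous P Q"
    and "causal_rejection_sampler M P Q X K"
  shows "channel_simulation_divergence P Q \<le> shannon_entropy M K"
proof -
  from assms(6) interpret M: prob_space M
    by (simp add: causal_rejection_sampler_def)
  from assms(6) have X [measurable]: "\<And>i. 1 \<le> i \<Longrightarrow> X i \<in> borel_measurable M"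
    and dP: "\<And>i. 1 \<le> i \<Longrightarrow> distr M borel (X i) = P"
    and K1: "\<And>\<omega>. \<omega> \<in> space M \<Longrightarrow> 1 \<le> K \<omega>"
    and stop: "stopping_time (natural_filtration M X) K"
    and dQ: "distr M borel (\<lambda>\<omega>. X (K \<omega>) \<omega>) = Q"
    by (auto simp: causal_rejection_sampler_def M.indep_vars_def)
  have K [measurable]: "K \<in> measurable M (count_space UNIV)"
    using X stop by (rule stopping_time_natural_filtration_measurable)
  \<comment> \<open>The probability of \<open>E k A\<close> is the mass that the sampler puts on
    \<open>A\<close> when it stops at index \<open>k\<close>.\<close>
  define E where "E k A = {\<omega> \<in> space M. K \<omega> = k \<and> X k \<omega> \<in> A}" for k A
  define p where "p k = measure M {\<omega> \<in> space M. K \<omega> = k}" for k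
  have E [measurable]: "E k A \<in> sets M" if "A \<in> sets borel" for k A
  \<comment> \<open>\<open>X 0\<close> is not assumed measurable, so index 0 is handled through
    \<open>K \<ge> 1\<close>, which makes the event empty.\<close>
  proof (cases "k = 0")
    case True
    then have "E k A = {}" using K1 by (force simp: E_def)
    then show ?thesis by simp
  next
    case False
    then have [measurable]: "X k \<in> borel_measurable M" by (intro X) simp
    note that [measurable]
    show ?thesis unfolding E_def by measurable
  qed
  have E_Un: "(\<lambda>\<omega>. X (K \<omega>) \<omega>) -` A \<inter> space M = (\<Union>k. E k A)" for A
    by (auto simp: E_def)
  \<comment> \<open>Each preimage is a countable union of the events \<open>E k A\<close>.
    Measurability is what allows \<open>emeasure_distr\<close> to evaluate \<open>Q\<close> on
    sets.\<close>
  have XK: "(\<lambda>\<omega>. X (K \<omega>) \<omega>) \<in> borel_measurable M"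
    using E by (intro measurableI) (auto simp: E_Un)
  have "disjoint_family (\<lambda>k. {\<omega> \<in> space M. K \<omega> = k})"
    by (auto simp: disjoint_family_on_def)
  then have "p sums measure M (\<Union>k. {\<omega> \<in> space M. K \<omega> = k})"
    unfolding p_def by (intro M.finite_measure_UNION) auto
  moreover have "(\<Union>k. {\<omega> \<in> space M. K \<omega> = k}) = space M" by auto
  ultimately have "p sums 1" by (simp add: M.prob_space)
  have "channel_simulation_divergence P Q \<le> (\<Sum>k. ennreal (- (p k * log 2 (p k))))"
  proof (rule channel_simulation_divergence_mixture_le[where \<mu>="\<lambda>k A. emeasure M (E k A)"])
    fix A assume "A \<in> sets P"
    then have A: "A \<in> sets borel" using assms by simp
    have "disjoint_family (\<lambda>k. E k A)"
      by (auto simp: disjoint_family_on_def E_def)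
    then show "emeasure Q A = (\<Sum>k. emeasure M (E k A))"
      using A E by (simp add: dQ[symmetric] emeasure_distr[OF XK] E_Un suminf_emeasure image_subset_iff)
    fix k
    show "emeasure M (E k A) \<le> emeasure P A"
    proof (cases "k = 0")
      case True
      then have "E k A = {}" using K1 by (force simp: E_def)
      then show ?thesis by simp
    next
      case False
      then have k: "1 \<le> k" by simp
      \<comment> \<open>Forgetting the condition \<open>K \<omega> = k\<close> leaves the event that
        \<open>X k\<close> lies in \<open>A\<close>, whose probability is
        \<open>P(A)\<close>.\<close>
      have "emeasure M (E k A) \<le> emeasure M (X k -` A \<inter> space M)"
        using measurable_sets[OF X[OF k] A] by (intro emeasure_mono) (auto simp: E_def)
      then show ?thesis
        using dP[OF k] emeasure_distr[OF X[OF k] A] by simp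
    qed
    show "emeasure M (E k A) \<le> ennreal (p k)"
      unfolding p_def M.emeasure_eq_measure[symmetric]
      by (intro emeasure_mono) (auto simp: E_def)
  qed (use assms \<open>p sums 1\<close> in \<open>auto simp: p_def[abs_def]\<close>)
  then show ?thesis
    by (simp add: shannon_entropy_def p_def Let_def)
qed

end
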